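(* Let $n\ge k\ge 1$ be integers and let $X_1,\dots,X_n$ be mutually independent non-negative random variables with finite expectations, each having a cumulative distribution function that is continuous everywhere. Let $\mathcal{A}^*$ be the optimal expected maximum value sampled by an adaptive probing policy probing $k$ of these variables, and let $\mathcal{S}^*=\max_{S\subseteq[n],\,|S|=k}\mathbb{E}[\max_{i\in S}X_i]$. Then $\mathcal{A}^*/\mathcal{S}^*\le \frac{e}{e-1}$.
   Context: An adaptive probing policy is a function $P$ that, given a state $(\kappa,r,T)$ with $\kappa\in\{1,\dots,k\}$ (probes remaining), $r\ge0$ (maximal value sampled so far), $T\subseteq[n]$ (indices not yet probed), returns an index $P(\kappa,r,T)\in T$ to probe next. Starting from state $(k,0,[n])$, it probes $X_{P(\kappa,r,T)}$, observes its value, and moves to $(\kappa-1,\max\{r,X_{P(\kappa,r,T)}\},T\setminus\{P(\kappa,r,T)\})$; at a state $(0,r,T)$ it stops with reward $r$. $\mathcal{A}^*$ is the maximum over all such policies of the expected reward. *)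

theory Defs
  imports "HOL-Probability.Probability"
begin

text \<open>
  A policy maps (probes remaining, maximal value so far, unprobed indices) to the index to be
  probed next. It has to be Borel measurable in the observed maximum, since otherwise its expected
  reward is undefined (and the Bochner integral below would silently be 0). Its values outside
  the state space are irrelevant.
\<close>

definition probing_policy :: "nat \<Rightarrow> nat \<Rightarrow> (nat \<Rightarrow> real \<Rightarrow> nat set \<Rightarrow> nat) \<Rightarrow> bool" where
  "probing_policy n k P \<longleftrightarrow>
     (\<forall>\<kappa>\<in>{1..k}. \<forall>T. T \<subseteq> {1..n} \<and> T \<noteq> {} \<longrightarrow>
        (\<forall>r\<ge>0. P \<kappa> r T \<in> T) \<and>
        (\<lambda>r. P \<kappa> r T) \<in> restrict_space borel {0..} \<rightarrow>\<^sub>M count_space UNIV)"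

primrec probing_reward ::
    "(nat \<Rightarrow> real \<Rightarrow> nat set \<Rightarrow> nat) \<Rightarrow> (nat \<Rightarrow> real) \<Rightarrow> nat \<Rightarrow> real \<Rightarrow> nat set \<Rightarrow> real" where
  "probing_reward P x 0 r T = r"
| "probing_reward P x (Suc \<kappa>) r T =
     (let i = P (Suc \<kappa>) r T in probing_reward P x \<kappa> (max r (x i)) (T - {i}))"

definition expected_reward ::
    "'a measure \<Rightarrow> (nat \<Rightarrow> 'a \<Rightarrow> real) \<Rightarrow> nat \<Rightarrow> nat \<Rightarrow> (nat \<Rightarrow> real \<Rightarrow> nat set \<Rightarrow> nat) \<Rightarrow> real" where
  "expected_reward M X n k P =
     (\<integral>\<omega>. probing_reward P (\<lambda>i. X i \<omega>) k 0 {1..n} \<partial>M)"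

text \<open>
  The optimal adaptive value is taken as a supremum over all policies, of which there are infinitely
  many. The set of expected rewards is nonempty by probing_policy_exists and bounded above by
  bdd_above_expected_reward, so this is a genuine supremum.
\<close>

definition adaptive_opt :: "'a measure \<Rightarrow> (nat \<Rightarrow> 'a \<Rightarrow> real) \<Rightarrow> nat \<Rightarrow> nat \<Rightarrow> real" where
  "adaptive_opt M X n k = (SUP P\<in>{P. probing_policy n k P}. expected_reward M X n k P)"

definition nonadaptive_opt :: "'a measure \<Rightarrow> (nat \<Rightarrow> 'a \<Rightarrow> real) \<Rightarrow> nat \<Rightarrow> nat \<Rightarrow> real" where
  "nonadaptive_opt M X n k =
     Max ((\<lambda>S. \<integral>\<omega>. (MAX i\<in>S. X i \<omega>) \<partial>M) ` {S. S \<subseteq> {1..n} \<and> card S = k})"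

lemma probing_policy_exists: "\<exists>P. probing_policy n k P"
proof -
  have "Min T \<in> T" if "T \<subseteq> {1..n}" "T \<noteq> {}" for T
    using Min_in[OF finite_subset[OF that(1) finite_atLeastAtMost] that(2)] .
  moreover have "(\<lambda>r. Min T) \<in> restrict_space borel {0::real..} \<rightarrow>\<^sub>M count_space UNIV" for T :: "nat set"
    by (rule measurable_const) simp
  ultimately have "probing_policy n k (\<lambda>_ _ T. Min T)"
    unfolding probing_policy_def by blast
  then show ?thesis by (rule exI[of "probing_policy n k"])
qed

lemma probing_reward_measurable:
  assumes P: "probing_policy n k P"
    and X: "\<And>i. i \<in> {1..n} \<Longrightarrow> X i \<in> borel_measurable M"
    and f: "f \<in> borel_measurable M" "\<And>\<omega>. \<omega> \<in> space M \<Longrightarrow> 0 \<le> f \<omega>"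
    and T: "T \<subseteq> {1..n}" "\<kappa> \<le> card T" "\<kappa> \<le> k"
  shows "(\<lambda>\<omega>. probing_reward P (\<lambda>i. X i \<omega>) \<kappa> (f \<omega>) T) \<in> borel_measurable M"
  using f T
proof (induction \<kappa> arbitrary: f T)
  case 0
  then show ?case by simp
next
  case (Suc \<kappa>)
  have ne: "T \<noteq> {}" using Suc.prems(4) by auto
  have fin: "finite T" using Suc.prems(3) finite_subset by auto
  have PT: "\<And>r. r \<ge> 0 \<Longrightarrow> P (Suc \<kappa>) r T \<in> T"
    and Pm: "(\<lambda>r. P (Suc \<kappa>) r T) \<in> restrict_space borel {0..} \<rightarrow>\<^sub>M count_space UNIV"
    using P Suc.prems(3,5) ne unfolding probing_policy_def by auto
  have fm: "f \<in> M \<rightarrow>\<^sub>M restrict_space borel {0..}"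
    using Suc.prems(1,2) by (intro measurable_restrict_space2) auto
  have g0: "(\<lambda>\<omega>. P (Suc \<kappa>) (f \<omega>) T) \<in> M \<rightarrow>\<^sub>M count_space UNIV"
    using measurable_compose[OF fm Pm] .
  have g: "(\<lambda>\<omega>. P (Suc \<kappa>) (f \<omega>) T) \<in> M \<rightarrow>\<^sub>M count_space T"
    unfolding measurable_count_space_eq2[OF fin]
    using PT Suc.prems(2) measurable_sets[OF g0] by (simp add: Pi_iff)
  have "(\<lambda>\<omega>. probing_reward P (\<lambda>i. X i \<omega>) \<kappa> (max (f \<omega>) (X i \<omega>)) (T - {i}))
          \<in> borel_measurable M" if i: "i \<in> T" for i
  proof (rule Suc.IH)
    show "(\<lambda>\<omega>. max (f \<omega>) (X i \<omega>)) \<in> borel_measurable M"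
      using Suc.prems(1,3) X i by (intro borel_measurable_max) auto
    show "\<kappa> \<le> card (T - {i})" using Suc.prems(4) i fin by (simp add: card_Diff_singleton)
  qed (use Suc.prems in \<open>auto simp: le_max_iff_disj\<close>)
  from measurable_compose_countable'[OF this g] fin show ?case
    by (simp add: Let_def countable_finite)
qed

lemma probing_reward_le_sum:
  assumes P: "probing_policy n k P" and T: "T \<subseteq> {1..n}" "\<kappa> \<le> card T" "\<kappa> \<le> k" and r: "0 \<le> r"
  shows "0 \<le> probing_reward P x \<kappa> r T \<and> probing_reward P x \<kappa> r T \<le> r + (\<Sum>i\<in>T. \<bar>x i\<bar>)"
  using T r
proof (induction \<kappa> arbitrary: r T)
  case 0
  then show ?case by (simp add: sum_nonneg)
next
  case (Suc \<kappa>)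
  have ne: "T \<noteq> {}" using Suc.prems(2) by auto
  have fin: "finite T" using Suc.prems(1) finite_subset by auto
  define i where "i = P (Suc \<kappa>) r T"
  have i: "i \<in> T"
    using P Suc.prems(1,3,4) ne unfolding probing_policy_def i_def by simp
  have "0 \<le> probing_reward P x \<kappa> (max r (x i)) (T - {i}) \<and>
        probing_reward P x \<kappa> (max r (x i)) (T - {i}) \<le> max r (x i) + (\<Sum>j\<in>T - {i}. \<bar>x j\<bar>)"
    using Suc.prems i fin by (intro Suc.IH) (auto simp: card_Diff_singleton)
  moreover have "(\<Sum>j\<in>T. \<bar>x j\<bar>) = \<bar>x i\<bar> + (\<Sum>j\<in>T - {i}. \<bar>x j\<bar>)"
    using fin i by (rule sum.remove)
  ultimately show ?case
    using Suc.prems(4) unfolding probing_reward.simps Let_def i_def[symmetric] by linarith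
qed

lemma bdd_above_expected_reward:
  assumes X: "\<And>i. i \<in> {1..n} \<Longrightarrow> integrable M (X i)" and "k \<le> n"
  shows "bdd_above (expected_reward M X n k ` {P. probing_policy n k P})"
proof (rule bdd_aboveI2)
  fix P assume "P \<in> {P. probing_policy n k P}"
  then have P: "probing_policy n k P" by simp
  have bnd: "0 \<le> probing_reward P (\<lambda>i. X i \<omega>) k 0 {1..n}"
    "probing_reward P (\<lambda>i. X i \<omega>) k 0 {1..n} \<le> (\<Sum>i\<in>{1..n}. \<bar>X i \<omega>\<bar>)" for \<omega>
    using probing_reward_le_sum[OF P, of "{1..n}" k 0 "\<lambda>i. X i \<omega>"] \<open>k \<le> n\<close> by auto
  have int: "integrable M (\<lambda>\<omega>. \<Sum>i\<in>{1..n}. \<bar>X i \<omega>\<bar>)"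
    using X by (intro Bochner_Integration.integrable_sum integrable_abs) auto
  have "(\<lambda>\<omega>. probing_reward P (\<lambda>i. X i \<omega>) k 0 {1..n}) \<in> borel_measurable M"
    using X \<open>k \<le> n\<close> by (intro probing_reward_measurable[OF P]) auto
  then have "integrable M (\<lambda>\<omega>. probing_reward P (\<lambda>i. X i \<omega>) k 0 {1..n})"
  proof (rule Bochner_Integration.integrable_bound[OF int])
    have "norm (probing_reward P (\<lambda>i. X i \<omega>) k 0 {1..n}) \<le> norm (\<Sum>i\<in>{1..n}. \<bar>X i \<omega>\<bar>)" for \<omega>
      using bnd[of \<omega>] unfolding real_norm_def by linarith
    then show "AE \<omega> in M. norm (probing_reward P (\<lambda>i. X i \<omega>) k 0 {1..n})
                 \<le> norm (\<Sum>i\<in>{1..n}. \<bar>X i \<omega>\<bar>)"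
      by (rule AE_I2)
  qed
  then show "expected_reward M X n k P \<le> (\<integral>\<omega>. (\<Sum>i\<in>{1..n}. \<bar>X i \<omega>\<bar>) \<partial>M)"
    unfolding expected_reward_def using int bnd(2) by (rule integral_mono)
qed

end

theory Submission
  imports Defs
begin

text \<open>
  Fix a policy, let \<open>p i\<close> be the probability that it probes \<open>i\<close>, so that the \<open>p i\<close> add up to \<open>k\<close>, and
  put \<open>q t i = P(X i > t)\<close>. Since the decision to probe \<open>i\<close> is independent of \<open>X i\<close>, a union bound
  shows that the reward exceeds \<open>t\<close> with probability at most \<open>min 1 (\<Sum>i. p i * q t i)\<close>. If every \<open>i\<close> is
  instead probed independently with probability \<open>p i\<close>, the maximum exceeds \<open>t\<close> with probability
  \<open>1 - (\<Prod>i. 1 - p i * q t i)\<close>, which is at least \<open>1 - 1/e\<close> times that bound. Pipage rounding replaces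
  this product distribution by a distribution on sets of size \<open>k\<close>, the same for all \<open>t\<close>, without
  decreasing the probability. Integrating over \<open>t\<close> compares the expectations.
\<close>

section \<open>Pipage rounding\<close>

text \<open>
  Along a direction that increases \<open>p i\<close> and decreases \<open>p j\<close> at the same rate the product is concave,
  so moving \<open>p\<close> to a random end of the segment within the unit cube, with mean \<open>p\<close>, does not increase
  the expected product, and each move makes a coordinate integral.
\<close>

lemma pipage_rounding:
  fixes p :: "'a \<Rightarrow> real"
  assumes "finite A" and "\<And>i. i \<in> A \<Longrightarrow> 0 \<le> p i" and "\<And>i. i \<in> A \<Longrightarrow> p i \<le> 1"
    and "sum p A = real k"
  shows "\<exists>w. (\<forall>S. 0 \<le> w S) \<and> (\<Sum>S | S \<subseteq> A \<and> card S = k. w S) = (1::real) \<and>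
    (\<forall>q. (\<forall>i\<in>A. 0 \<le> q i \<and> q i \<le> 1) \<longrightarrow>
      (\<Sum>S | S \<subseteq> A \<and> card S = k. w S * (\<Prod>i\<in>S. 1 - q i)) \<le> (\<Prod>i\<in>A. 1 - p i * q i))"
  using assms(2-)
proof (induction "card {i\<in>A. 0 < p i \<and> p i < 1}" arbitrary: p rule: less_induct)
  case less
  note fin = \<open>finite A\<close>
  have fK: "finite {S. S \<subseteq> A \<and> card S = k}" using fin by simp
  show ?case
  proof (cases "\<exists>i\<in>A. 0 < p i \<and> p i < 1")
    case False
    then have p01: "p i = 0 \<or> p i = 1" if "i \<in> A" for i
      using less.prems(1,2)[OF that] that by force
    \<comment> \<open>Without fractional coordinates \<open>p\<close> is the indicator of
      \<open>S0\<close>, and the point mass at \<open>S0\<close> gives equality.\<close>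
    define S0 where "S0 = {i\<in>A. p i = 1}"
    have "sum p A = (\<Sum>i\<in>A. if p i = 1 then 1 else 0)"
      by (rule sum.cong) (use p01 in auto)
    also have "\<dots> = real (card S0)"
      unfolding S0_def using fin by (simp flip: sum.inter_filter)
    finally have "card S0 = k" using less.prems(3) by simp
    then have S0: "S0 \<in> {S. S \<subseteq> A \<and> card S = k}" by (auto simp: S0_def)
    show ?thesis
    proof (intro exI[of _ "\<lambda>S. if S = S0 then 1 else 0"] conjI allI impI)
      fix q :: "'a \<Rightarrow> real"
      have "(\<Prod>i\<in>A. 1 - p i * q i) = (\<Prod>i\<in>A. if p i = 1 then 1 - q i else 1)"
        by (rule prod.cong) (use p01 in auto)
      also have "\<dots> = (\<Prod>i\<in>S0. 1 - q i)"
        unfolding S0_def using fin by (simp flip: prod.inter_filter)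
      finally show "(\<Sum>S | S \<subseteq> A \<and> card S = k. (if S = S0 then 1 else 0) * (\<Prod>i\<in>S. 1 - q i))
          \<le> (\<Prod>i\<in>A. 1 - p i * q i)"
        using S0 fK by (simp add: if_distrib[of "\<lambda>x. x * _"] sum.delta cong: if_cong)
    qed (use S0 fK in \<open>auto simp: sum.delta\<close>)
  next
    case True
    then obtain i where i: "i \<in> A" "0 < p i" "p i < 1" by blast
    \<comment> \<open>A second fractional coordinate exists because the coordinates add up to an
      integer.\<close>
    have "\<exists>j\<in>A - {i}. 0 < p j \<and> p j < 1"
    proof (rule ccontr)
      assume "\<not> ?thesis"
      then have "p j \<in> \<int>" if "j \<in> A - {i}" for j
        using less.prems(1,2)[of j] that by (cases "p j = 0"; cases "p j = 1"; force)
      then have "sum p (A - {i}) \<in> \<int>" by (rule Ints_sum)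
      moreover have "p i = real k - sum p (A - {i})"
        using sum.remove[OF fin i(1), of p] less.prems(3) by simp
      ultimately have "p i \<in> \<int>" by simp
      then obtain m where "p i = of_int m" by (elim Ints_cases)
      with i show False by simp
    qed
    then obtain j where j: "j \<in> A" "j \<noteq> i" "0 < p j" "p j < 1" by blast
    define shift where "shift s = p(i := p i + s, j := p j - s)" for s
    define frac where "frac p = {i\<in>A. 0 < p i \<and> p i < (1::real)}" for p
    have A: "A = insert i (insert j (A - {i, j}))" using i j by auto
    \<comment> \<open>The induction hypothesis at an end of the segment: by \<open>hit\<close>,
      \<open>i\<close> or \<open>j\<close> becomes integral there, so the set of fractional
      coordinates shrinks strictly.\<close>
    have rounded: "\<exists>w. (\<forall>S. 0 \<le> w S) \<and> (\<Sum>S | S \<subseteq> A \<and> card S = k. w S) = (1::real) \<and>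
        (\<forall>q. (\<forall>i\<in>A. 0 \<le> q i \<and> q i \<le> 1) \<longrightarrow>
          (\<Sum>S | S \<subseteq> A \<and> card S = k. w S * (\<Prod>i\<in>S. 1 - q i)) \<le> (\<Prod>l\<in>A. 1 - shift s l * q l))"
      if s: "0 \<le> p i + s" "p i + s \<le> 1" "0 \<le> p j - s" "p j - s \<le> 1"
        and hit: "p i + s \<in> {0, 1} \<or> p j - s \<in> {0, 1}" for s
    proof (rule less.hyps)
      have "frac (shift s) \<subset> frac p"
      proof
        show "frac (shift s) \<subseteq> frac p"
          using i j by (auto simp: frac_def shift_def)
        have "i \<notin> frac (shift s) \<or> j \<notin> frac (shift s)"
          using hit j by (auto simp: frac_def shift_def)
        moreover have "i \<in> frac p" "j \<in> frac p"
          using i j by (auto simp: frac_def)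
        ultimately show "frac (shift s) \<noteq> frac p" by blast
      qed
      then show "card {i\<in>A. 0 < shift s i \<and> shift s i < 1} < card {i\<in>A. 0 < p i \<and> p i < 1}"
        unfolding frac_def using fin by (intro psubset_card_mono) auto
      have "sum (shift s) A = sum p A"
        using fin j
        by (subst (1 2) A) (auto simp: shift_def intro!: sum.cong)
      then show "sum (shift s) A = real k" using less.prems(3) by simp
    qed (use s less.prems j in \<open>auto simp: shift_def\<close>)
    \<comment> \<open>\<open>a\<close> is the longest move within the unit cube that raises
      \<open>p i\<close> and lowers \<open>p j\<close>, and \<open>b\<close> the longest in the
      reverse direction.\<close>
    define a where "a = min (1 - p i) (p j)"
    define b where "b = min (p i) (1 - p j)"
    have ab: "0 < a" "0 < b" using i j by (auto simp: a_def b_def)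
    have a: "0 \<le> p i + a" "p i + a \<le> 1" "0 \<le> p j - a" "p j - a \<le> 1"
        "p i + a \<in> {0, 1} \<or> p j - a \<in> {0, 1}"
      using i j unfolding a_def insert_iff by linarith+
    have b: "0 \<le> p i + - b" "p i + - b \<le> 1" "0 \<le> p j - - b" "p j - - b \<le> 1"
        "p i + - b \<in> {0, 1} \<or> p j - - b \<in> {0, 1}"
      using i j unfolding b_def insert_iff by linarith+
    obtain u where u: "\<forall>S. 0 \<le> u S" "(\<Sum>S | S \<subseteq> A \<and> card S = k. u S) = (1::real)"
      "\<And>q. (\<forall>i\<in>A. 0 \<le> q i \<and> q i \<le> 1) \<Longrightarrow>
        (\<Sum>S | S \<subseteq> A \<and> card S = k. u S * (\<Prod>i\<in>S. 1 - q i)) \<le> (\<Prod>l\<in>A. 1 - shift a l * q l)"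
      using rounded[OF a] by blast
    obtain v where v: "\<forall>S. 0 \<le> v S" "(\<Sum>S | S \<subseteq> A \<and> card S = k. v S) = (1::real)"
      "\<And>q. (\<forall>i\<in>A. 0 \<le> q i \<and> q i \<le> 1) \<Longrightarrow>
        (\<Sum>S | S \<subseteq> A \<and> card S = k. v S * (\<Prod>i\<in>S. 1 - q i)) \<le> (\<Prod>l\<in>A. 1 - shift (-b) l * q l)"
      using rounded[OF b] by blast
    \<comment> \<open>Moving by \<open>a\<close> with probability \<open>c\<close> and by
      \<open>-b\<close> otherwise has mean displacement \<open>c * a - (1 - c) * b\<close>, which
      this choice makes zero.\<close>
    define c where "c = b / (a + b)"
    have c: "0 \<le> c" "0 \<le> 1 - c" "c * a = (1 - c) * b"
      using ab by (auto simp: c_def field_simps)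
    show ?thesis
    proof (intro exI[of _ "\<lambda>S. c * u S + (1 - c) * v S"] conjI allI impI)
      show "0 \<le> c * u S + (1 - c) * v S" for S using c u(1) v(1) by simp
      show "(\<Sum>S | S \<subseteq> A \<and> card S = k. c * u S + (1 - c) * v S) = 1"
        using u(2) v(2) by (simp add: sum.distrib flip: sum_distrib_left)
      fix q :: "'a \<Rightarrow> real" assume q: "\<forall>i\<in>A. 0 \<le> q i \<and> q i \<le> 1"
      define R where "R = (\<Prod>l\<in>A - {i, j}. 1 - p l * q l)"
      have R: "0 \<le> R"
        unfolding R_def using q less.prems by (auto intro!: prod_nonneg mult_le_one)
      have shift: "(\<Prod>l\<in>A. 1 - shift s l * q l) = (1 - (p i + s) * q i) * (1 - (p j - s) * q j) * R" for s
        using fin j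
        by (subst A) (auto simp: shift_def R_def intro!: prod.cong)
      have p: "(\<Prod>l\<in>A. 1 - p l * q l) = (1 - p i * q i) * (1 - p j * q j) * R"
        using shift[of 0] by (simp add: shift_def)
      have "(\<Sum>S | S \<subseteq> A \<and> card S = k. (c * u S + (1 - c) * v S) * (\<Prod>i\<in>S. 1 - q i)) =
          c * (\<Sum>S | S \<subseteq> A \<and> card S = k. u S * (\<Prod>i\<in>S. 1 - q i)) +
          (1 - c) * (\<Sum>S | S \<subseteq> A \<and> card S = k. v S * (\<Prod>i\<in>S. 1 - q i))"
        by (simp add: sum_distrib_left distrib_right sum.distrib mult.assoc)
      also have "\<dots> \<le> c * (\<Prod>l\<in>A. 1 - shift a l * q l) + (1 - c) * (\<Prod>l\<in>A. 1 - shift (-b) l * q l)"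
        using c u(3)[OF q] v(3)[OF q] by (intro add_mono mult_left_mono)
      \<comment> \<open>The product is quadratic in the shift with leading coefficient
        \<open>- (q i * q j * R)\<close>: the linear terms cancel by the choice of \<open>c\<close>,
        and the quadratic ones can only lower the value.\<close>
      also have "\<dots> = (\<Prod>l\<in>A. 1 - p l * q l)
          + (c * a - (1 - c) * b) * (p j * q i * q j - p i * q i * q j - q i + q j) * R
          - (c * a^2 + (1 - c) * b^2) * (q i * q j * R)"
        unfolding shift p by (simp add: algebra_simps power2_eq_square)
      also have "\<dots> \<le> (\<Prod>l\<in>A. 1 - p l * q l)"
        using c R q i j by (simp add: add_nonneg_nonneg)
      finally show "(\<Sum>S | S \<subseteq> A \<and> card S = k. (c * u S + (1 - c) * v S) * (\<Prod>i\<in>S. 1 - q i))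
          \<le> (\<Prod>i\<in>A. 1 - p i * q i)" .
    qed
  qed
qed

section \<open>Exponential bounds and the layer-cake formula\<close>

text \<open>Since \<open>exp\<close> is convex, the concave function \<open>1 - exp (-s)\<close>
  lies above its chord on \<open>[0, 1]\<close>; beyond \<open>1\<close> it increases while the left
  side is constant.\<close>

lemma one_minus_inverse_e_min_le:
  fixes s :: real
  assumes "0 \<le> s"
  shows "(1 - exp (-1)) * min 1 s \<le> 1 - exp (-s)"
proof (cases "s \<le> 1")
  case True
  have "exp ((1 - s) *\<^sub>R 0 + s *\<^sub>R (-1)) \<le> (1 - s) * exp 0 + s * exp (-1::real)"
    using True assms by (intro convex_onD[OF exp_convex]) auto
  then show ?thesis using True by (simp add: algebra_simps)
next
  case False
  then show ?thesis by simp
qed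

text \<open>Each factor satisfies \<open>1 - f i \<le> exp (- f i)\<close>, and
  \<open>f i \<le> 1\<close> keeps the factors nonnegative, so that these inequalities can be
  multiplied.\<close>

lemma prod_one_minus_le_exp:
  fixes f :: "'a \<Rightarrow> real"
  assumes "\<And>i. i \<in> A \<Longrightarrow> f i \<le> 1"
  shows "(\<Prod>i\<in>A. 1 - f i) \<le> exp (- sum f A)"
proof (cases "finite A")
  case True
  have "1 - f i \<le> exp (- f i)" for i using exp_ge_add_one_self[of "- f i"] by simp
  then have "(\<Prod>i\<in>A. 1 - f i) \<le> (\<Prod>i\<in>A. exp (- f i))"
    using assms by (intro prod_mono) auto
  also have "\<dots> = exp (- sum f A)"
    using True by (simp add: exp_sum flip: sum_negf)
  finally show ?thesis .
\<comment> \<open>Over an infinite set the product defaults to \<open>1\<close> and the sum to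
  \<open>0\<close>.\<close>
qed simp

text \<open>Tonelli, applied to \<open>Y \<omega>\<close> as the length of
  \<open>[0, Y \<omega>)\<close>. Where \<open>Y\<close> is negative this interval is empty and
  \<open>ennreal\<close> truncates to \<open>0\<close>.\<close>

lemma nn_integral_layer_cake:
  fixes Y :: "'a \<Rightarrow> real"
  assumes "sigma_finite_measure M" and [measurable]: "Y \<in> borel_measurable M"
  shows "(\<integral>\<^sup>+\<omega>. ennreal (Y \<omega>) \<partial>M) =
    (\<integral>\<^sup>+t. emeasure M {\<omega>\<in>space M. t < Y \<omega>} * indicator {0..} t \<partial>lborel)"
proof -
  interpret M: sigma_finite_measure M by fact
  interpret pair_sigma_finite lborel M ..
  have "(\<integral>\<^sup>+\<omega>. ennreal (Y \<omega>) \<partial>M) = (\<integral>\<^sup>+\<omega>. (\<integral>\<^sup>+t. indicator {0..<Y \<omega>} t \<partial>lborel) \<partial>M)"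
  proof (rule nn_integral_cong)
    show "ennreal (Y \<omega>) = (\<integral>\<^sup>+t. indicator {0..<Y \<omega>} t \<partial>lborel)" for \<omega>
      by (cases "0 \<le> Y \<omega>") (auto simp: ennreal_neg)
  qed
  also have "\<dots> = (\<integral>\<^sup>+\<omega>. (\<integral>\<^sup>+t. (if 0 \<le> t \<and> t < Y \<omega> then 1 else 0) \<partial>lborel) \<partial>M)"
    by (intro nn_integral_cong) (auto simp: indicator_def)
  also have "\<dots> = (\<integral>\<^sup>+t. (\<integral>\<^sup>+\<omega>. (if 0 \<le> t \<and> t < Y \<omega> then 1 else 0) \<partial>M) \<partial>lborel)"
    by (rule Fubini') measurable
  also have "\<dots> = (\<integral>\<^sup>+t. (\<integral>\<^sup>+\<omega>. indicator {\<omega>\<in>space M. t < Y \<omega>} \<omega> * indicator {0..} t \<partial>M) \<partial>lborel)"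
    by (intro nn_integral_cong) (auto simp: indicator_def)
  also have "\<dots> = (\<integral>\<^sup>+t. emeasure M {\<omega>\<in>space M. t < Y \<omega>} * indicator {0..} t \<partial>lborel)"
    by (simp add: nn_integral_multc)
  finally show ?thesis .
qed

section \<open>The set of probed indices\<close>

text \<open>The recursion passes through the same states as \<open>probing_reward\<close>, so that
  both can be handled in one induction.\<close>

primrec probed_set ::
    "(nat \<Rightarrow> real \<Rightarrow> nat set \<Rightarrow> nat) \<Rightarrow> (nat \<Rightarrow> real) \<Rightarrow> nat \<Rightarrow> real \<Rightarrow> nat set \<Rightarrow> nat set" where
  "probed_set P x 0 r T = {}"
| "probed_set P x (Suc \<kappa>) r T =
     (let i = P (Suc \<kappa>) r T in insert i (probed_set P x \<kappa> (max r (x i)) (T - {i})))"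

lemma probing_policy_in:
  assumes "probing_policy n k P" "T \<subseteq> {1..n}" "Suc \<kappa> \<le> card T" "Suc \<kappa> \<le> k" "0 \<le> r"
  shows "P (Suc \<kappa>) r T \<in> T"
proof -
  have "T \<noteq> {}" using assms(3) by auto
  moreover have "Suc \<kappa> \<in> {1..k}" using assms(4) by simp
  ultimately show ?thesis using assms(1,2,5) unfolding probing_policy_def by blast
qed

text \<open>A probed index leaves \<open>T\<close> before the recursive call, so every step
  contributes a new one. The count makes the probing probabilities add up to
  \<open>k\<close>.\<close>

lemma probed_set_subset_card:
  assumes P: "probing_policy n k P" and "T \<subseteq> {1..n}" "\<kappa> \<le> card T" "\<kappa> \<le> k" "0 \<le> r"
  shows "probed_set P x \<kappa> r T \<subseteq> T \<and> card (probed_set P x \<kappa> r T) = \<kappa>"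
  using assms(2-)
proof (induction \<kappa> arbitrary: r T)
  case (Suc \<kappa>)
  define i where "i = P (Suc \<kappa>) r T"
  have fin: "finite T" using Suc.prems(1) finite_subset by auto
  have i: "i \<in> T" unfolding i_def using probing_policy_in[OF P] Suc.prems by blast
  have "probed_set P x \<kappa> (max r (x i)) (T - {i}) \<subseteq> T - {i} \<and>
      card (probed_set P x \<kappa> (max r (x i)) (T - {i})) = \<kappa>"
    using Suc.prems i fin by (intro Suc.IH) (auto simp: card_Diff_singleton)
  moreover from this have "finite (probed_set P x \<kappa> (max r (x i)) (T - {i}))"
    using fin finite_subset by blast
  ultimately show ?case
    using i by (auto simp: Let_def card_insert_if simp flip: i_def)
qed simp

text \<open>As long as the values seen are at most \<open>t\<close>, so is the running maximum; only
  a probed value can lift it above \<open>t\<close>. This prepares the union bound.\<close>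

lemma probing_reward_gtD:
  "\<lbrakk>t < probing_reward P x \<kappa> r T; r \<le> t\<rbrakk> \<Longrightarrow> \<exists>i\<in>probed_set P x \<kappa> r T. t < x i"
proof (induction \<kappa> arbitrary: r T)
  case (Suc \<kappa>)
  define i where "i = P (Suc \<kappa>) r T"
  show ?case
  proof (cases "t < x i")
    case False
    with Suc show ?thesis by (fastforce simp: Let_def simp flip: i_def)
  qed (auto simp: Let_def simp flip: i_def)
qed simp

text \<open>Whether \<open>i\<close> gets probed is decided before \<open>x i\<close> is seen.\<close>

lemma mem_probed_set_cong:
  assumes P: "probing_policy n k P" and "T \<subseteq> {1..n}" "\<kappa> \<le> card T" "\<kappa> \<le> k" "0 \<le> r"
    and "\<And>j. j \<in> T - {i} \<Longrightarrow> x j = y j"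
  shows "i \<in> probed_set P x \<kappa> r T \<longleftrightarrow> i \<in> probed_set P y \<kappa> r T"
  using assms(2-)
proof (induction \<kappa> arbitrary: r T)
  case (Suc \<kappa>)
  define j where "j = P (Suc \<kappa>) r T"
  have j: "j \<in> T" unfolding j_def using probing_policy_in[OF P] Suc.prems by blast
  have fin: "finite T" using Suc.prems(1) finite_subset by auto
  show ?case
  \<comment> \<open>If \<open>i\<close> is probed now, both sides hold; otherwise \<open>x\<close>
    and \<open>y\<close> agree at \<open>j\<close>, and both runs move to the same state.\<close>
  proof (cases "i = j")
    case False
    have "i \<in> probed_set P x \<kappa> (max r (x j)) (T - {j}) \<longleftrightarrow>
        i \<in> probed_set P y \<kappa> (max r (x j)) (T - {j})"
      using Suc.prems j fin by (intro Suc.IH) (auto simp: card_Diff_singleton)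
    with j False Suc.prems(5) show ?thesis by (simp add: Let_def flip: j_def)
  qed (simp add: Let_def flip: j_def)
qed simp

text \<open>The next index is a measurable function into the finite set \<open>T\<close>, so the
  event is glued from finitely many branches.\<close>

lemma mem_probed_set_measurable:
  assumes P: "probing_policy n k P"
    and X: "\<And>i. i \<in> {1..n} \<Longrightarrow> X i \<in> borel_measurable M"
    and f: "f \<in> borel_measurable M" "\<And>\<omega>. \<omega> \<in> space M \<Longrightarrow> 0 \<le> f \<omega>"
    and T: "T \<subseteq> {1..n}" "\<kappa> \<le> card T" "\<kappa> \<le> k"
  shows "Measurable.pred M (\<lambda>\<omega>. j \<in> probed_set P (\<lambda>i. X i \<omega>) \<kappa> (f \<omega>) T)"
  using f T
proof (induction \<kappa> arbitrary: f T)
  case (Suc \<kappa>)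
  have ne: "T \<noteq> {}" using Suc.prems(4) by auto
  have fin: "finite T" using Suc.prems(3) finite_subset by auto
  have Pm: "(\<lambda>r. P (Suc \<kappa>) r T) \<in> restrict_space borel {0..} \<rightarrow>\<^sub>M count_space UNIV"
    using P Suc.prems(3,5) ne unfolding probing_policy_def by auto
  have fm: "f \<in> M \<rightarrow>\<^sub>M restrict_space borel {0..}"
    using Suc.prems(1,2) by (intro measurable_restrict_space2) auto
  have g0: "(\<lambda>\<omega>. P (Suc \<kappa>) (f \<omega>) T) \<in> M \<rightarrow>\<^sub>M count_space UNIV"
    using measurable_compose[OF fm Pm] .
  have g: "(\<lambda>\<omega>. P (Suc \<kappa>) (f \<omega>) T) \<in> M \<rightarrow>\<^sub>M count_space T"
    unfolding measurable_count_space_eq2[OF fin]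
    using probing_policy_in[OF P Suc.prems(3-5)] Suc.prems(2) measurable_sets[OF g0]
    by (simp add: Pi_iff)
  have "Measurable.pred M
      (\<lambda>\<omega>. j = i \<or> j \<in> probed_set P (\<lambda>i. X i \<omega>) \<kappa> (max (f \<omega>) (X i \<omega>)) (T - {i}))"
    if i: "i \<in> T" for i
  proof (intro pred_intros_logic Suc.IH)
    show "(\<lambda>\<omega>. max (f \<omega>) (X i \<omega>)) \<in> borel_measurable M"
      using Suc.prems(1,3) X i by (intro borel_measurable_max) auto
    show "\<kappa> \<le> card (T - {i})" using Suc.prems(4) i fin by (simp add: card_Diff_singleton)
  qed (use Suc.prems in \<open>auto simp: le_max_iff_disj\<close>)
  from measurable_compose_countable'[OF this g] fin show ?case
    by (simp add: Let_def countable_finite)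
qed simp

section \<open>Independence and tail probabilities\<close>

text \<open>By \<open>mem_probed_set_cong\<close> the event of probing \<open>i\<close> is
  determined by the other variables, which are jointly independent of \<open>X i\<close>.\<close>

lemma (in prob_space) prob_mem_probed_set_Int:
  assumes P: "probing_policy n k P" and "k \<le> n" and X: "indep_vars (\<lambda>_. borel) X {1..n}"
    and i: "i \<in> {1..n}"
  defines "D \<equiv> \<lambda>\<omega>. probed_set P (\<lambda>j. X j \<omega>) k 0 {1..n}"
  shows "\<P>(\<omega> in M. i \<in> D \<omega> \<and> t < X i \<omega>) = \<P>(\<omega> in M. i \<in> D \<omega>) * \<P>(\<omega> in M. t < X i \<omega>)"
proof -
  let ?A = "{1..n} - {i}"
  let ?N = "\<lambda>A. Pi\<^sub>M A (\<lambda>_. borel :: real measure)"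
  let ?Y = "\<lambda>A \<omega>. restrict (\<lambda>j. X j \<omega>) A"
  \<comment> \<open>The values of the other variables for which \<open>i\<close> gets probed;
    \<open>0\<close> is a placeholder for the missing coordinate \<open>i\<close>.\<close>
  define E where "E = {x \<in> space (?N ?A). i \<in> probed_set P (\<lambda>j. if j = i then 0 else x j) k 0 {1..n}}"
  have "(\<lambda>x. if j = i then 0 else x j) \<in> borel_measurable (?N ?A)" if "j \<in> {1..n}" for j
    using that by (cases "j = i") (auto intro: measurable_component_singleton)
  then have E: "E \<in> sets (?N ?A)"
    unfolding E_def using \<open>k \<le> n\<close> mem_probed_set_measurable[OF P, of _ "?N ?A" "\<lambda>_. 0" "{1..n}" k i]
    by (intro predE) simp
  have memE: "?Y ?A \<omega> \<in> E \<longleftrightarrow> i \<in> D \<omega>" for \<omega>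
  proof -
    have "i \<in> probed_set P (\<lambda>j. if j = i then 0 else ?Y ?A \<omega> j) k 0 {1..n} \<longleftrightarrow> i \<in> D \<omega>"
      unfolding D_def using \<open>k \<le> n\<close> by (intro mem_probed_set_cong[OF P]) auto
    then show ?thesis unfolding E_def by (simp only: mem_Collect_eq) (simp add: space_PiM)
  qed
  have indep: "indep_var (?N ?A) (?Y ?A) (?N {i}) (?Y {i})"
    using i by (intro indep_var_restrict[OF X]) auto
  have F: "{x \<in> space (?N {i}). t < x i} \<in> sets (?N {i})" by measurable
  have "\<P>(\<omega> in M. ?Y ?A \<omega> \<in> E \<and> ?Y {i} \<omega> \<in> {x \<in> space (?N {i}). t < x i}) =
      \<P>(\<omega> in M. ?Y ?A \<omega> \<in> E) * \<P>(\<omega> in M. ?Y {i} \<omega> \<in> {x \<in> space (?N {i}). t < x i})"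
    using indep_varD[OF indep E F]
    by (simp only: vimage_def Int_def mem_Collect_eq mem_Times_iff fst_conv snd_conv conj_ac)
  then show ?thesis unfolding memE by (simp add: space_PiM)
qed

text \<open>The maximum is at most \<open>t\<close> exactly if every \<open>X i\<close> is, and
  independence factors the probability of this complement.\<close>

lemma (in prob_space) prob_Max_gt:
  fixes X :: "'b \<Rightarrow> 'a \<Rightarrow> real"
  assumes X: "indep_vars (\<lambda>_. borel) X I" and S: "S \<subseteq> I" "finite S" "S \<noteq> {}"
  shows "\<P>(\<omega> in M. t < (MAX i\<in>S. X i \<omega>)) = 1 - (\<Prod>i\<in>S. 1 - \<P>(\<omega> in M. t < X i \<omega>))"
proof -
  have [measurable]: "X i \<in> borel_measurable M" if "i \<in> S" for i
    using X S(1) that by (auto simp: indep_vars_def)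
  have "\<P>(\<omega> in M. t < (MAX i\<in>S. X i \<omega>)) = \<P>(\<omega> in M. \<not> (\<forall>i\<in>S. X i \<omega> \<le> t))"
    using S by (intro arg_cong[of _ _ prob]) (auto simp: Max_gr_iff not_le)
  also have "\<dots> = 1 - \<P>(\<omega> in M. \<forall>i\<in>S. X i \<omega> \<le> t)"
    using S by (intro prob_neg) measurable
  also have "\<P>(\<omega> in M. \<forall>i\<in>S. X i \<omega> \<le> t) = prob (\<Inter>i\<in>S. X i -` {..t} \<inter> space M)"
    using S by (intro arg_cong[of _ _ prob]) auto
  also have "\<dots> = (\<Prod>i\<in>S. prob (X i -` {..t} \<inter> space M))"
    using X S by (intro indep_varsD) auto
  also have "\<dots> = (\<Prod>i\<in>S. 1 - \<P>(\<omega> in M. t < X i \<omega>))"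
  proof (rule prod.cong[OF refl])
    fix i assume i: "i \<in> S"
    have "prob (X i -` {..t} \<inter> space M) = \<P>(\<omega> in M. \<not> t < X i \<omega>)"
      by (intro arg_cong[of _ _ prob]) auto
    also have "\<dots> = 1 - \<P>(\<omega> in M. t < X i \<omega>)"
      using i by (intro prob_neg) measurable
    finally show "prob (X i -` {..t} \<inter> space M) = 1 - \<P>(\<omega> in M. t < X i \<omega>)" .
  qed
  finally show ?thesis .
qed

section \<open>Comparison for a single policy\<close>

lemma (in prob_space) expected_reward_le:
  assumes P: "probing_policy n k P" and k: "1 \<le> k" "k \<le> n"
    and X: "indep_vars (\<lambda>_. borel) X {1..n}"
    and X0: "\<And>i. i \<in> {1..n} \<Longrightarrow> AE \<omega> in M. 0 \<le> X i \<omega>"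
    and int: "\<And>i. i \<in> {1..n} \<Longrightarrow> integrable M (X i)"
  shows "(1 - exp (-1)) * expected_reward M X n k P \<le> nonadaptive_opt M X n k"
proof -
  have [measurable]: "X i \<in> borel_measurable M" if "i \<in> {1..n}" for i
    using int[OF that] by auto
  define K where "K = {S. S \<subseteq> {1..n} \<and> card S = k}"
  define Y where "Y S \<omega> = (MAX i\<in>S. X i \<omega>)" for S \<omega>
  define Z where "Z \<omega> = probing_reward P (\<lambda>i. X i \<omega>) k 0 {1..n}" for \<omega>
  define D where "D \<omega> = probed_set P (\<lambda>i. X i \<omega>) k 0 {1..n}" for \<omega>
  define p where "p i = \<P>(\<omega> in M. i \<in> D \<omega>)" for i
  define q where "q t i = \<P>(\<omega> in M. t < X i \<omega>)" for t i
  have K: "S \<subseteq> {1..n}" "finite S" "S \<noteq> {}" if "S \<in> K" for S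
    using that k finite_subset[of S "{1..n}"] by (auto simp: K_def)
  have finK: "finite K" by (simp add: K_def)
  have neK: "K \<noteq> {}" using obtain_subset_with_card_n[of k "{1..n}"] k by (auto simp: K_def)
  have Ym[measurable]: "Y S \<in> borel_measurable M" if "S \<in> K" for S
    unfolding Y_def using K[OF that] by (intro borel_measurable_Max) auto
  have Y_bound: "norm (Y S \<omega>) \<le> norm (\<Sum>i\<in>{1..n}. \<bar>X i \<omega>\<bar>)" if "S \<in> K" for S \<omega>
  proof -
    have "Y S \<omega> \<in> (\<lambda>i. X i \<omega>) ` S"
      unfolding Y_def using K[OF that] by (intro Max_in) auto
    then obtain i where i: "i \<in> S" "Y S \<omega> = X i \<omega>" by auto
    then have "\<bar>Y S \<omega>\<bar> \<le> (\<Sum>i\<in>{1..n}. \<bar>X i \<omega>\<bar>)"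
      using K(1)[OF that] by (auto intro!: member_le_sum)
    then show ?thesis by simp
  qed
  have intY: "integrable M (Y S)" if "S \<in> K" for S
    by (rule Bochner_Integration.integrable_bound[where f = "\<lambda>\<omega>. \<Sum>i\<in>{1..n}. \<bar>X i \<omega>\<bar>"])
      (use int Ym[OF that] Y_bound[OF that] in auto)
  have Y0: "AE \<omega> in M. 0 \<le> Y S \<omega>" if "S \<in> K" for S
  proof -
    from K(3)[OF that] obtain i where i: "i \<in> S" by blast
    with K(1)[OF that] have "AE \<omega> in M. 0 \<le> X i \<omega>" by (intro X0) auto
    then show ?thesis
      by eventually_elim (use i K(2)[OF that] in \<open>auto simp: Y_def intro: Max_ge order.trans\<close>)
  qed
  have D: "D \<omega> \<subseteq> {1..n}" "card (D \<omega>) = k" for \<omega>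
    unfolding D_def using probed_set_subset_card[OF P, of "{1..n}" k 0] k by auto
  have Dm[measurable]: "Measurable.pred M (\<lambda>\<omega>. i \<in> D \<omega>)" for i
    unfolding D_def using k mem_probed_set_measurable[OF P, of X M "\<lambda>_. 0" "{1..n}" k i] by auto
  have D_sets: "{\<omega>\<in>space M. i \<in> D \<omega>} \<in> events" for i
    by measurable
  have Zm[measurable]: "Z \<in> borel_measurable M"
    unfolding Z_def using k by (intro probing_reward_measurable[OF P]) auto
  \<comment> \<open>The running maximum starts at \<open>0\<close>, so this holds everywhere, while
    \<open>Y0\<close> holds almost everywhere.\<close>
  have Z0: "0 \<le> Z \<omega>" for \<omega>
    unfolding Z_def using probing_reward_le_sum[OF P, of "{1..n}" k 0] k by auto
  have p: "0 \<le> p i" "p i \<le> 1" for i by (auto simp: p_def)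
  have q: "0 \<le> q t i" "q t i \<le> 1" for t i by (auto simp: q_def)
  \<comment> \<open>Exactly \<open>k\<close> indices are probed in every outcome, so the expected
    number of probed indices is \<open>k\<close>.\<close>
  have "real k = (\<integral>\<omega>. (\<Sum>i\<in>{1..n}. indicator {\<omega>\<in>space M. i \<in> D \<omega>} \<omega>) \<partial>M)"
  proof -
    have "(\<Sum>i\<in>{1..n}. indicator {\<omega>\<in>space M. i \<in> D \<omega>} \<omega>) = real k" if "\<omega> \<in> space M" for \<omega>
    proof -
      have "(\<Sum>i\<in>{1..n}. indicator {\<omega>\<in>space M. i \<in> D \<omega>} \<omega>) = (\<Sum>i\<in>{1..n}. if i \<in> D \<omega> then 1 else 0::real)"
        using that by (intro sum.cong) (auto simp: indicator_def)
      also have "\<dots> = real (card {i\<in>{1..n}. i \<in> D \<omega>})"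
        by (simp flip: sum.inter_filter)
      also have "{i\<in>{1..n}. i \<in> D \<omega>} = D \<omega>" using D(1)[of \<omega>] by blast
      finally show ?thesis using D(2) by simp
    qed
    then have "(\<integral>\<omega>. (\<Sum>i\<in>{1..n}. indicator {\<omega>\<in>space M. i \<in> D \<omega>} \<omega>) \<partial>M) = (\<integral>\<omega>. real k \<partial>M)"
      by (intro Bochner_Integration.integral_cong) auto
    then show ?thesis by (simp add: prob_space)
  qed
  also have "\<dots> = sum p {1..n}"
    by (subst Bochner_Integration.integral_sum)
      (auto simp: p_def D_sets emeasure_eq_measure intro!: integrable_real_indicator)
  finally have sum_p: "sum p {1..n} = real k" by simp
  \<comment> \<open>The weights are fixed before \<open>t\<close>, and \<open>w(3)\<close> covers
    every \<open>q t\<close>; hence the tail bounds below can be integrated.\<close>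
  obtain w where w: "\<And>S. 0 \<le> w S" "sum w K = 1"
    "\<And>q. \<forall>i\<in>{1..n}. 0 \<le> q i \<and> q i \<le> 1 \<Longrightarrow>
      (\<Sum>S\<in>K. w S * (\<Prod>i\<in>S. 1 - q i)) \<le> (\<Prod>i\<in>{1..n}. 1 - p i * q i)"
    using pipage_rounding[of "{1..n}" p k] p sum_p unfolding K_def by auto
  have tail: "(1 - exp (-1)) * \<P>(\<omega> in M. t < Z \<omega>) \<le> (\<Sum>S\<in>K. w S * \<P>(\<omega> in M. t < Y S \<omega>))"
    if "0 \<le> t" for t
  proof -
    let ?s = "\<Sum>i\<in>{1..n}. p i * q t i"
    have "\<P>(\<omega> in M. t < Z \<omega>) \<le> prob (\<Union>i\<in>{1..n}. {\<omega>\<in>space M. i \<in> D \<omega> \<and> t < X i \<omega>})"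
    proof (rule finite_measure_mono)
      show "{\<omega>\<in>space M. t < Z \<omega>} \<subseteq> (\<Union>i\<in>{1..n}. {\<omega>\<in>space M. i \<in> D \<omega> \<and> t < X i \<omega>})"
        using probing_reward_gtD[OF _ that] D(1) unfolding Z_def D_def by fastforce
    qed measurable
    also have "\<dots> \<le> (\<Sum>i\<in>{1..n}. \<P>(\<omega> in M. i \<in> D \<omega> \<and> t < X i \<omega>))"
      by (intro finite_measure_subadditive_finite) (auto intro!: sets.sets_Collect)
    also have "\<dots> = ?s"
      using prob_mem_probed_set_Int[OF P k(2) X, of _ t] unfolding p_def q_def D_def
      by (intro sum.cong) auto
    \<comment> \<open>The union bound is combined with the trivial bound \<open>1\<close> on a
      probability.\<close>
    finally have "(1 - exp (-1)) * \<P>(\<omega> in M. t < Z \<omega>) \<le> (1 - exp (-1)) * min 1 ?s"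
      by (intro mult_left_mono) auto
    also have "\<dots> \<le> 1 - exp (- ?s)"
      using p q by (intro one_minus_inverse_e_min_le sum_nonneg) auto
    also have "\<dots> \<le> 1 - (\<Prod>i\<in>{1..n}. 1 - p i * q t i)"
      using prod_one_minus_le_exp[of "{1..n}" "\<lambda>i. p i * q t i"] p q by (simp add: mult_le_one)
    also have "\<dots> \<le> 1 - (\<Sum>S\<in>K. w S * (\<Prod>i\<in>S. 1 - q t i))"
      using w(3)[of "q t"] q by simp
    also have "\<dots> = (\<Sum>S\<in>K. w S * (1 - (\<Prod>i\<in>S. 1 - q t i)))"
      by (simp add: right_diff_distrib sum_subtractf w(2))
    also have "\<dots> = (\<Sum>S\<in>K. w S * \<P>(\<omega> in M. t < Y S \<omega>))"
      unfolding Y_def q_def using K by (intro sum.cong) (simp_all add: prob_Max_gt[OF X])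
    finally show ?thesis .
  qed
  \<comment> \<open>The tail bound is integrated over \<open>t\<close> in \<open>ennreal\<close>; by
    \<open>Z0\<close> and \<open>Y0\<close> the truncation at \<open>0\<close> is harmless.\<close>
  have "ennreal ((1 - exp (-1)) * expectation Z) \<le> ennreal (\<Sum>S\<in>K. w S * expectation (Y S))"
  proof -
    have "ennreal ((1 - exp (-1)) * expectation Z) \<le> ennreal (1 - exp (-1)) * (\<integral>\<^sup>+\<omega>. ennreal (Z \<omega>) \<partial>M)"
    \<comment> \<open>For non-integrable \<open>Z\<close> the Bochner integral on the left defaults
      to \<open>0\<close>.\<close>
    proof (cases "integrable M Z")
      case True
      then show ?thesis using Z0 by (simp add: ennreal_mult' nn_integral_eq_integral)
    qed (simp add: not_integrable_integral_eq)
    also have "\<dots> = (\<integral>\<^sup>+t. ennreal (1 - exp (-1)) * (emeasure M {\<omega>\<in>space M. t < Z \<omega>} * indicator {0..} t) \<partial>lborel)"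
      by (subst nn_integral_layer_cake) (auto simp: sigma_finite_measure_axioms nn_integral_cmult)
    also have "\<dots> \<le> (\<integral>\<^sup>+t. (\<Sum>S\<in>K. ennreal (w S) *
        (emeasure M {\<omega>\<in>space M. t < Y S \<omega>} * indicator {0..} t)) \<partial>lborel)"
    proof (rule nn_integral_mono)
      fix t :: real
      show "ennreal (1 - exp (-1)) * (emeasure M {\<omega>\<in>space M. t < Z \<omega>} * indicator {0..} t) \<le>
        (\<Sum>S\<in>K. ennreal (w S) * (emeasure M {\<omega>\<in>space M. t < Y S \<omega>} * indicator {0..} t))"
      proof (cases "0 \<le> t")
        case True
        then show ?thesis using tail[OF True] w(1)
          by (simp add: emeasure_eq_measure ennreal_leI sum_ennreal flip: ennreal_mult' ennreal_mult'')
      qed simp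
    qed
    also have "\<dots> = (\<Sum>S\<in>K. ennreal (w S) * (\<integral>\<^sup>+\<omega>. ennreal (Y S \<omega>) \<partial>M))"
      by (subst nn_integral_sum) (auto simp: nn_integral_layer_cake sigma_finite_measure_axioms nn_integral_cmult intro!: sum.cong)
    also have "\<dots> = (\<Sum>S\<in>K. ennreal (w S * expectation (Y S)))"
      using intY Y0 w(1) by (intro sum.cong) (simp_all add: nn_integral_eq_integral ennreal_mult')
    also have "\<dots> = ennreal (\<Sum>S\<in>K. w S * expectation (Y S))"
      using w(1) Y0 by (intro sum_ennreal) (simp add: integral_nonneg_AE)
    finally show ?thesis .
  qed
  then have "(1 - exp (-1)) * expectation Z \<le> (\<Sum>S\<in>K. w S * expectation (Y S))"
    using w(1) Y0 by (subst (asm) ennreal_le_iff) (auto intro!: sum_nonneg simp: integral_nonneg_AE)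
  \<comment> \<open>A weighted average of the values of the sets is at most their maximum.\<close>
  also have "\<dots> \<le> (\<Sum>S\<in>K. w S * nonadaptive_opt M X n k)"
    using w(1) finK unfolding nonadaptive_opt_def Y_def K_def[symmetric]
    by (intro sum_mono mult_left_mono Max_ge) auto
  also have "\<dots> = nonadaptive_opt M X n k"
    using w(2) by (simp flip: sum_distrib_right)
  finally show ?thesis unfolding expected_reward_def Z_def .
qed

section \<open>Passage to the supremum over all policies\<close>

theorem theorem3:
  fixes M :: "'a measure" and X :: "nat \<Rightarrow> 'a \<Rightarrow> real" and n k :: nat
  assumes "prob_space M"
    and "1 \<le> k" and "k \<le> n"
    and "prob_space.indep_vars M (\<lambda>_. borel) X {1..n}"
    and "\<And>i. i \<in> {1..n} \<Longrightarrow> AE \<omega> in M. 0 \<le> X i \<omega>"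
    and "\<And>i. i \<in> {1..n} \<Longrightarrow> integrable M (X i)"
    and "\<And>i. i \<in> {1..n} \<Longrightarrow> continuous_on UNIV (cdf (distr M borel (X i)))"
  shows "adaptive_opt M X n k / nonadaptive_opt M X n k \<le> exp 1 / (exp 1 - 1)"
proof -
  interpret prob_space M by fact
  define c :: real where "c = 1 - exp (-1)"
  have c: "0 < c" "exp 1 / (exp 1 - 1) = 1 / c"
    by (auto simp: c_def exp_minus field_simps)
  have le: "c * expected_reward M X n k P \<le> nonadaptive_opt M X n k" if "probing_policy n k P" for P
    unfolding c_def using assms that by (intro expected_reward_le) auto
  have "adaptive_opt M X n k \<le> nonadaptive_opt M X n k / c"
    unfolding adaptive_opt_def using le probing_policy_exists c
    by (intro cSUP_least) (auto simp: field_simps)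
  \<comment> \<open>Any policy has a nonnegative expected reward, and \<open>le\<close> transfers
    the sign.\<close>
  moreover have "0 \<le> nonadaptive_opt M X n k"
  proof -
    obtain P where P: "probing_policy n k P" using probing_policy_exists by blast
    have "0 \<le> expected_reward M X n k P"
      unfolding expected_reward_def using probing_reward_le_sum[OF P, of "{1..n}" k 0] \<open>k \<le> n\<close>
      by (intro integral_nonneg_AE) auto
    then have "0 \<le> c * expected_reward M X n k P" using c by simp
    then show ?thesis using le[OF P] by linarith
  qed
  \<comment> \<open>If the denominator is zero, the quotient is \<open>0\<close> by
    convention.\<close>
  ultimately show ?thesis
    unfolding c(2) using c(1) by (cases "nonadaptive_opt M X n k = 0") (auto simp: field_simps)
qed

end
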